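(* Let $(A,\cdot,\alpha)$ be a Hom-associative algebra, let $(V,l,r,\beta)$ be a bimodule of $A$, and let $\mathcal K:V\to A$ be a relative averaging operator on $A$ with respect to $(V,l,r,\beta)$. Then the operations $$u\vdash_{\mathcal K}v=l(\mathcal K(u))v,\qquad u\dashv_{\mathcal K}v=r(\mathcal K(v))u,\qquad u,v\in V,$$ define a Hom-associative dialgebra structure on $V$, with twisting map $\beta$.
   Context: All vector spaces are over a field $\mathbb K$ of characteristic $0$. All Hom-algebras are multiplicative, i.e. the twisting map preserves every bilinear operation of the structure. A Hom-associative algebra $(A,\cdot,\alpha)$ is a vector space $A$ with a bilinear operation $\cdot$ and a linear map $\alpha:A\to A$ such that $(x\cdot y)\cdot\alpha(z)=\alpha(x)\cdot(y\cdot z)$ for all $x,y,z\in A$. A bimodule $(V,l,r,\beta)$ of $(A,\cdot,\alpha)$ is a vector space $V$ with a linear map $\beta:V\to V$ and linear maps $l,r:A\to \mathrm{End}(V)$ such that for all $x,y\in A$: $\beta l(x)=l(\alpha(x))\beta$, $\beta r(x)=r(\alpha(x))\beta$, $l(x\cdot y)\beta=l(\alpha(x))l(y)$, $r(x\cdot y)\beta=r(\alpha(y))r(x)$, $l(\alpha(x))r(y)=r(\alpha(y))l(x)$. A linear map $\mathcal K:V\to A$ is a relative averaging operator on $A$ with respect to $(V,l,r,\beta)$ if $\mathcal K\beta=\alpha\mathcal K$ and $\mathcal K(u)\cdot\mathcal K(v)=\mathcal K(l(\mathcal K(u))v)=\mathcal K(r(\mathcal K(v))u)$ for all $u,v\in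 V$. A Hom-associative dialgebra $(D,\vdash,\dashv,\alpha)$ is a vector space $D$ with bilinear operations $\vdash,\dashv$ and a linear map $\alpha:D\to D$ such that for all $x,y,z\in D$: $(x\dashv y)\vdash\alpha(z)=(x\vdash y)\vdash\alpha(z)$; $\alpha(x)\dashv(y\dashv z)=\alpha(x)\dashv(y\vdash z)$; $(x\dashv y)\dashv\alpha(z)=\alpha(x)\dashv(y\dashv z)$; $(x\vdash y)\vdash\alpha(z)=\alpha(x)\vdash(y\vdash z)$; $(x\vdash y)\dashv\alpha(z)=\alpha(x)\vdash(y\dashv z)$. *)

theory Defs
  imports Complex_Main
begin

definition bilinear_map ::
  "('k::field \<Rightarrow> 'a::ab_group_add \<Rightarrow> 'a) \<Rightarrow> ('k \<Rightarrow> 'b::ab_group_add \<Rightarrow> 'b) \<Rightarrow>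
   ('k \<Rightarrow> 'c::ab_group_add \<Rightarrow> 'c) \<Rightarrow> ('a \<Rightarrow> 'b \<Rightarrow> 'c) \<Rightarrow> bool"
  where "bilinear_map sa sb sc f \<longleftrightarrow>
    (\<forall>x. Vector_Spaces.linear sb sc (f x)) \<and> (\<forall>y. Vector_Spaces.linear sa sc (\<lambda>x. f x y))"

locale hom_associative_algebra = vector_space scaleA
  for scaleA :: "'k::field_char_0 \<Rightarrow> 'a::ab_group_add \<Rightarrow> 'a" +
  fixes mult :: "'a \<Rightarrow> 'a \<Rightarrow> 'a"  (infixl \<open>\<cdot>\<close> 70)
    and \<alpha> :: "'a \<Rightarrow> 'a"
  assumes mult_bilinear: "bilinear_map scaleA scaleA scaleA mult"
    and twist_linear: "Vector_Spaces.linear scaleA scaleA \<alpha>"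
    and multiplicative: "\<alpha> (x \<cdot> y) = \<alpha> x \<cdot> \<alpha> y"
    and hom_assoc: "(x \<cdot> y) \<cdot> \<alpha> z = \<alpha> x \<cdot> (y \<cdot> z)"

(* A linear map A \<rightarrow> End(V) is given in curried form, i.e. as a bilinear map A \<times> V \<rightarrow> V. *)
locale hom_bimodule = hom_associative_algebra scaleA mult \<alpha> + V: vector_space scaleV
  for scaleA :: "'k::field_char_0 \<Rightarrow> 'a::ab_group_add \<Rightarrow> 'a"
    and mult :: "'a \<Rightarrow> 'a \<Rightarrow> 'a"  (infixl \<open>\<cdot>\<close> 70)
    and \<alpha> :: "'a \<Rightarrow> 'a"
    and scaleV :: "'k \<Rightarrow> 'v::ab_group_add \<Rightarrow> 'v" +
  fixes l r :: "'a \<Rightarrow> 'v \<Rightarrow> 'v"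
    and \<beta> :: "'v \<Rightarrow> 'v"
  assumes module_twist_linear: "Vector_Spaces.linear scaleV scaleV \<beta>"
    and left_action_bilinear: "bilinear_map scaleA scaleV scaleV l"
    and right_action_bilinear: "bilinear_map scaleA scaleV scaleV r"
    and twist_left: "\<beta> \<circ> l x = l (\<alpha> x) \<circ> \<beta>"
    and twist_right: "\<beta> \<circ> r x = r (\<alpha> x) \<circ> \<beta>"
    and left_mult: "l (x \<cdot> y) \<circ> \<beta> = l (\<alpha> x) \<circ> l y"
    and right_mult: "r (x \<cdot> y) \<circ> \<beta> = r (\<alpha> y) \<circ> r x"
    and left_right: "l (\<alpha> x) \<circ> r y = r (\<alpha> y) \<circ> l x"

locale relative_averaging_operator = hom_bimodule scaleA mult \<alpha> scaleV l r \<beta>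
  for scaleA :: "'k::field_char_0 \<Rightarrow> 'a::ab_group_add \<Rightarrow> 'a"
    and mult :: "'a \<Rightarrow> 'a \<Rightarrow> 'a"  (infixl \<open>\<cdot>\<close> 70)
    and \<alpha> :: "'a \<Rightarrow> 'a"
    and scaleV :: "'k \<Rightarrow> 'v::ab_group_add \<Rightarrow> 'v"
    and l r :: "'a \<Rightarrow> 'v \<Rightarrow> 'v"
    and \<beta> :: "'v \<Rightarrow> 'v" +
  fixes K :: "'v \<Rightarrow> 'a"
  assumes operator_linear: "Vector_Spaces.linear scaleV scaleA K"
    and operator_twist: "K \<circ> \<beta> = \<alpha> \<circ> K"
    and averaging_left: "K u \<cdot> K v = K (l (K u) v)"
    and averaging_right: "K u \<cdot> K v = K (r (K v) u)"

locale hom_associative_dialgebra = vector_space scaleD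
  for scaleD :: "'k::field_char_0 \<Rightarrow> 'd::ab_group_add \<Rightarrow> 'd" +
  fixes lprod :: "'d \<Rightarrow> 'd \<Rightarrow> 'd"  (infixl \<open>\<turnstile>\<close> 70)
    and rprod :: "'d \<Rightarrow> 'd \<Rightarrow> 'd"  (infixl \<open>\<stileturn>\<close> 70)
    and \<alpha> :: "'d \<Rightarrow> 'd"
  assumes lprod_bilinear: "bilinear_map scaleD scaleD scaleD lprod"
    and rprod_bilinear: "bilinear_map scaleD scaleD scaleD rprod"
    and twist_linear: "Vector_Spaces.linear scaleD scaleD \<alpha>"
    and lprod_multiplicative: "\<alpha> (x \<turnstile> y) = \<alpha> x \<turnstile> \<alpha> y"
    and rprod_multiplicative: "\<alpha> (x \<stileturn> y) = \<alpha> x \<stileturn> \<alpha> y"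
    and left_bar: "(x \<stileturn> y) \<turnstile> \<alpha> z = (x \<turnstile> y) \<turnstile> \<alpha> z"
    and right_bar: "\<alpha> x \<stileturn> (y \<stileturn> z) = \<alpha> x \<stileturn> (y \<turnstile> z)"
    and rprod_assoc: "(x \<stileturn> y) \<stileturn> \<alpha> z = \<alpha> x \<stileturn> (y \<stileturn> z)"
    and lprod_assoc: "(x \<turnstile> y) \<turnstile> \<alpha> z = \<alpha> x \<turnstile> (y \<turnstile> z)"
    and inner_assoc: "(x \<turnstile> y) \<stileturn> \<alpha> z = \<alpha> x \<turnstile> (y \<stileturn> z)"

end

theory Submission
  imports Defs
begin

text \<open>
  The bimodule axioms, evaluated on the image of \<open>K\<close>, become identities for the two products
  because of two properties of \<open>K\<close>. By the averaging identities, \<open>K\<close> sends both products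
  \<open>u \<turnstile> v = l (K u) v\<close> and \<open>u \<stileturn> v = r (K v) u\<close> to the same element \<open>K u \<cdot> K v\<close>. Acting through
  \<open>K\<close> on \<open>\<beta> w\<close> therefore cannot distinguish the products (the two bar identities), and it
  amounts to the action of a product of \<open>A\<close>, which the bimodule axioms split into two actions
  (associativity of each operation). As \<open>K\<close> also commutes with the twists, \<open>\<beta>\<close> on an acting
  argument becomes \<open>\<alpha>\<close> on its image: the twisted axioms then match exactly, and inner
  associativity becomes the compatibility of the left and right actions.
\<close>

lemma bilinear_map_compose_left:
  assumes "bilinear_map sa sb sc f" and "Vector_Spaces.linear sd sa g"
  shows "bilinear_map sd sb sc (\<lambda>u v. f (g u) v)"
proof -
  have "Vector_Spaces.linear sd sc (\<lambda>u. f (g u) v)" for v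
    using Vector_Spaces.linear_compose[OF assms(2), of sc "\<lambda>x. f x v"] assms(1)
    by (simp add: bilinear_map_def o_def)
  with assms(1) show ?thesis
    by (simp add: bilinear_map_def)
qed

lemma bilinear_map_swap:
  "bilinear_map sa sb sc f \<Longrightarrow> bilinear_map sb sa sc (\<lambda>x y. f y x)"
  by (simp add: bilinear_map_def)

theorem theorem3p9:
  fixes scaleA :: "'k::field_char_0 \<Rightarrow> 'a::ab_group_add \<Rightarrow> 'a"
    and mult :: "'a \<Rightarrow> 'a \<Rightarrow> 'a"
    and \<alpha> :: "'a \<Rightarrow> 'a"
    and scaleV :: "'k \<Rightarrow> 'v::ab_group_add \<Rightarrow> 'v"
    and l r :: "'a \<Rightarrow> 'v \<Rightarrow> 'v"
    and \<beta> :: "'v \<Rightarrow> 'v"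
    and K :: "'v \<Rightarrow> 'a"
  assumes "hom_associative_algebra scaleA mult \<alpha>"
    and "hom_bimodule scaleA mult \<alpha> scaleV l r \<beta>"
    and "relative_averaging_operator scaleA mult \<alpha> scaleV l r \<beta> K"
  shows "hom_associative_dialgebra scaleV (\<lambda>u v. l (K u) v) (\<lambda>u v. r (K v) u) \<beta>"
proof -
  interpret relative_averaging_operator scaleA mult \<alpha> scaleV l r \<beta> K
    by (fact assms(3))
  have K_twist: "K (\<beta> u) = \<alpha> (K u)" for u
    using operator_twist by (simp add: fun_eq_iff)
  have K_left: "K (l (K u) v) = mult (K u) (K v)" for u v
    by (simp add: averaging_left)
  have K_right: "K (r (K v) u) = mult (K u) (K v)" for u v
    by (simp add: averaging_right)
  show ?thesis
  proof (intro hom_associative_dialgebra.intro hom_associative_dialgebra_axioms.intro)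
    show "vector_space scaleV"
      by (fact V.vector_space_axioms)
    show "bilinear_map scaleV scaleV scaleV (\<lambda>u v. l (K u) v)"
      by (rule bilinear_map_compose_left[OF left_action_bilinear operator_linear])
    show "bilinear_map scaleV scaleV scaleV (\<lambda>u v. r (K v) u)"
      by (rule bilinear_map_swap[OF
            bilinear_map_compose_left[OF right_action_bilinear operator_linear]])
    show "Vector_Spaces.linear scaleV scaleV \<beta>"
      by (fact module_twist_linear)
  next
    fix x y z
    show "\<beta> (l (K x) y) = l (K (\<beta> x)) (\<beta> y)"
      using twist_left[of "K x"] by (simp add: K_twist fun_eq_iff)
    show "\<beta> (r (K y) x) = r (K (\<beta> y)) (\<beta> x)"
      using twist_right[of "K y"] by (simp add: K_twist fun_eq_iff)
    show "l (K (r (K y) x)) (\<beta> z) = l (K (l (K x) y)) (\<beta> z)"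
      by (simp add: K_left K_right)
    show "r (K (r (K z) y)) (\<beta> x) = r (K (l (K y) z)) (\<beta> x)"
      by (simp add: K_left K_right)
    show "r (K (\<beta> z)) (r (K y) x) = r (K (r (K z) y)) (\<beta> x)"
      using right_mult[of "K y" "K z"] by (simp add: K_twist K_right fun_eq_iff)
    show "l (K (l (K x) y)) (\<beta> z) = l (K (\<beta> x)) (l (K y) z)"
      using left_mult[of "K x" "K y"] by (simp add: K_twist K_left fun_eq_iff)
    show "r (K (\<beta> z)) (l (K x) y) = l (K (\<beta> x)) (r (K z) y)"
      using left_right[of "K x" "K z"] by (simp add: K_twist fun_eq_iff)
  qed
qed

end
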